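(* Let $N\ge 2$ and let $\mathcal{H}=\mathcal{H}^{(1)}\otimes\cdots\otimes\mathcal{H}^{(N)}$ with each $\mathcal{H}^{(j)}$ a complex Hilbert space of finite dimension $D^{(j)}\ge 2$. For each $j$ let $\{A_k^{(j)}\}_{k=1}^{(D^{(j)})^2-1}$ be a basis of the real vector space of traceless Hermitian operators on $\mathcal{H}^{(j)}$ that is orthonormal with respect to $(A,B)=\operatorname{Tr}(AB)$. Let $\rho=|\psi\rangle\langle\psi|$ be a pure state on $\mathcal{H}$, let $\rho^{(j)}$ be its reduced state on $\mathcal{H}^{(j)}$ (partial trace over all other factors), and let $\langle A_k^{(j)}\rangle_\rho=\operatorname{Tr}\bigl(\rho\,(A_k^{(j)}\otimes\mathbb{I}^{(r)})\bigr)$. With $\mathcal{E}^{(j)}_{\mathcal{M}^j}$ and the normalized General Entanglement $E_g$ defined in the context (observables normalized by $\|A\|^2=\operatorname{Tr}A^2$), for every $j$ and every projective measurement $\mathcal{M}^j$ on the rest of the system, $$\mathcal{E}^{(j)}_{\mathcal{M}^j}(\rho)=1-\frac1{D^{(j)}}-\sum_k\langle A_k^{(j)}\rangle_\rho^2,$$ so that $\mathcal{E}^{(j)}_{\mathcal{M}^j}(\rho)$ does not depend on $\mathcal{M}^j$, and $$E_g(\rho)=1-\frac1N\sum_{j=1}^N\frac{D^{(j)}}{D^{(j)}-1}\sum_k\langle A_k^{(j)}\rangle_\rho^2=1+\frac1N\sum_{j=1}^N\frac{1}{D^{(j)}-1}-\frac1N\sum_{j=1}^N\frac{D^{(j)}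}{D^{(j)}-1}\operatorname{Tr}\bigl((\rho^{(j)})^2\bigr).$$
   Context: For $j\in\{1,\dots,N\}$, let $\mathcal{H}^{(r)}=\bigotimes_{k\ne j}\mathcal{H}^{(k)}$ denote the rest of the system, so that $\mathcal{H}\cong\mathcal{H}^{(j)}\otimes\mathcal{H}^{(r)}$; $\mathbb{I}^{(r)}$ is the identity on $\mathcal{H}^{(r)}$. A projective measurement $\mathcal{M}^j$ on the rest of the system is a family $\{\mathcal{P}_i\}$ with $\mathcal{P}_i=\mathbb{I}^{(j)}\otimes\mathcal{P}_i^{(r)}$, where $\mathcal{P}_i^{(r)}=|\chi_i\rangle\langle\chi_i|$ and $\{|\chi_i\rangle\}$ is an orthonormal basis of $\mathcal{H}^{(r)}$. For a pure state $\rho=|\psi\rangle\langle\psi|$, outcome $i$ occurs with probability $p_i=\operatorname{Tr}(\rho\mathcal{P}_i)$, and if $p_i\neq 0$ the post-measurement state is $\rho_i=\frac{1}{p_i}\mathcal{P}_i\rho\mathcal{P}_i$. Outcomes with $p_i=0$ contribute $0$ to the sum below. Let $\Omega^{(j)}$ be the set of operators $\mathcal{O}=\mathcal{O}^{(j)}\otimes\mathbb{I}^{(r)}$ with $\mathcal{O}^{(j)}$ a Hermitian operator on $\mathcal{H}^{(j)}$, $\operatorname{Tr}\mathcal{O}^{(j)}=0$ and $\operatorname{Tr}\bigl((\mathcal{O}^{(j)})^2\bigr)=1$. Define $$R_{\mathcal{O}}^{(j),\mathcal{P}_i}(\rho)=\bigl(\operatorname{Tr}(\rho\mathcal{O})-\operatorname{Tr}(\rho_i\mathcal{O})\bigr)^2,\qquad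 \mathcal{E}^{(j)}_{\mathcal{M}^j}(\rho)=\sum_i p_i\max_{\mathcal{O}\in\Omega^{(j)}}R_{\mathcal{O}}^{(j),\mathcal{P}_i}(\rho).$$ The normalized General Entanglement is $$E_g(\rho)=\frac1N\sum_{j=1}^N\Bigl(1-\frac{1}{D^{(j)}}\Bigr)^{-1}\max_{\mathcal{M}^j}\mathcal{E}^{(j)}_{\mathcal{M}^j}(\rho),$$ the maximum being over all projective measurements $\mathcal{M}^j$ on the rest of the system. *)

theory Defs
  imports "Jordan_Normal_Form.Schur_Decomposition" "Jordan_Normal_Form.VS_Connect"
begin

text \<open>
  The party \<open>j \<in> {1..N}\<close> has state space \<open>\<complex>\<^bsup>D j\<^esup>\<close>, and a tensor product of such spaces is
  represented by its Kronecker coordinates: the product basis vector with digits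
  \<open>s k < D k\<close> for \<open>k \<in> {1..N}\<close> has the mixed radix index \<open>\<Sum>k\<in>{1..N}. s k * (\<Prod>l\<in>{k<..N}. D l)\<close>,
  and similarly with the factor \<open>j\<close> left out. Inner products, traces and adjoints refer to
  these orthonormal coordinates.
\<close>

definition total_dim :: "nat \<Rightarrow> (nat \<Rightarrow> nat) \<Rightarrow> nat" where
  "total_dim N D = (\<Prod>k\<in>{1..N}. D k)"

definition rest_dim :: "nat \<Rightarrow> (nat \<Rightarrow> nat) \<Rightarrow> nat \<Rightarrow> nat" where
  "rest_dim N D j = (\<Prod>k\<in>{1..N} - {j}. D k)"

definition place :: "nat \<Rightarrow> (nat \<Rightarrow> nat) \<Rightarrow> nat \<Rightarrow> nat" where
  "place N D j = (\<Prod>k\<in>{j<..N}. D k)"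

text \<open>
  The identification of the whole space with (factor \<open>j\<close>) \<open>\<otimes>\<close> (rest) on indices: digit \<open>j\<close> of \<open>a\<close>;
  the index obtained from \<open>a\<close> by deleting digit \<open>j\<close>; and the inverse operation of inserting
  digit \<open>s\<close> at position \<open>j\<close> into an index \<open>r\<close> of the rest.
\<close>

definition digit :: "nat \<Rightarrow> (nat \<Rightarrow> nat) \<Rightarrow> nat \<Rightarrow> nat \<Rightarrow> nat" where
  "digit N D j a = (a div place N D j) mod D j"

definition del_digit :: "nat \<Rightarrow> (nat \<Rightarrow> nat) \<Rightarrow> nat \<Rightarrow> nat \<Rightarrow> nat" where
  "del_digit N D j a =
     (a div (place N D j * D j)) * place N D j + a mod place N D j"

definition ins_digit :: "nat \<Rightarrow> (nat \<Rightarrow> nat) \<Rightarrow> nat \<Rightarrow> nat \<Rightarrow> nat \<Rightarrow> nat" where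
  "ins_digit N D j s r =
     ((r div place N D j) * D j + s) * place N D j + r mod place N D j"

definition tensor_at ::
    "nat \<Rightarrow> (nat \<Rightarrow> nat) \<Rightarrow> nat \<Rightarrow> complex mat \<Rightarrow> complex mat \<Rightarrow> complex mat" where
  "tensor_at N D j A B = mat (total_dim N D) (total_dim N D)
     (\<lambda>(a, b). A $$ (digit N D j a, digit N D j b)
             * B $$ (del_digit N D j a, del_digit N D j b))"

definition reduced_state ::
    "nat \<Rightarrow> (nat \<Rightarrow> nat) \<Rightarrow> nat \<Rightarrow> complex mat \<Rightarrow> complex mat" where
  "reduced_state N D j \<rho> = mat (D j) (D j)
     (\<lambda>(s, t). \<Sum>r<rest_dim N D j. \<rho> $$ (ins_digit N D j s r, ins_digit N D j t r))"

definition mtrace :: "complex mat \<Rightarrow> complex" where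
  "mtrace A = (\<Sum>i<dim_row A. A $$ (i, i))"

text \<open>Expectation values are real for Hermitian arguments; \<open>Re\<close> only adjusts the type.\<close>

definition expect :: "complex mat \<Rightarrow> complex mat \<Rightarrow> real" where
  "expect \<rho> X = Re (mtrace (\<rho> * X))"

definition ket_bra :: "complex vec \<Rightarrow> complex mat" where
  "ket_bra v = mat (dim_vec v) (dim_vec v) (\<lambda>(a, b). v $ a * cnj (v $ b))"

definition traceless_hermitian :: "nat \<Rightarrow> complex mat set" where
  "traceless_hermitian n = {A \<in> carrier_mat n n. mat_adjoint A = A \<and> mtrace A = 0}"

text \<open>
  An orthonormal basis \<open>A 1, \<dots>, A (n\<^sup>2 - 1)\<close> of the real vector space of traceless Hermitian
  matrices; linear independence is implied by orthonormality.
\<close>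

definition traceless_onb :: "nat \<Rightarrow> (nat \<Rightarrow> complex mat) \<Rightarrow> bool" where
  "traceless_onb n A \<longleftrightarrow>
     (\<forall>k\<in>{1..n\<^sup>2 - 1}. A k \<in> traceless_hermitian n) \<and>
     (\<forall>k\<in>{1..n\<^sup>2 - 1}. \<forall>l\<in>{1..n\<^sup>2 - 1}. mtrace (A k * A l) = (if k = l then 1 else 0)) \<and>
     (\<forall>B\<in>traceless_hermitian n. \<exists>c :: nat \<Rightarrow> real.
        B = mat n n (\<lambda>(s, t). \<Sum>k\<in>{1..n\<^sup>2 - 1}. of_real (c k) * A k $$ (s, t)))"

definition orthonormal_basis :: "nat \<Rightarrow> complex vec set \<Rightarrow> bool" where
  "orthonormal_basis n S \<longleftrightarrow>
     vectorspace.basis class_ring (module_vec TYPE(complex) n) S \<and>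
     (\<forall>u\<in>S. \<forall>v\<in>S. u \<bullet>c v = (if u = v then 1 else 0))"

text \<open>
  A measurement is the set of its projections; distinct members of an orthonormal basis
  give distinct projections, so no outcome is lost by forgetting the labels.
\<close>

definition rest_measurements ::
    "nat \<Rightarrow> (nat \<Rightarrow> nat) \<Rightarrow> nat \<Rightarrow> complex mat set set" where
  "rest_measurements N D j =
     {(\<lambda>\<chi>. tensor_at N D j (1\<^sub>m (D j)) (ket_bra \<chi>)) ` S | S.
        orthonormal_basis (rest_dim N D j) S}"

definition post_state :: "complex mat \<Rightarrow> complex mat \<Rightarrow> complex mat" where
  "post_state \<rho> P = complex_of_real (1 / expect \<rho> P) \<cdot>\<^sub>m (P * \<rho> * P)"

definition local_observables ::
    "nat \<Rightarrow> (nat \<Rightarrow> nat) \<Rightarrow> nat \<Rightarrow> complex mat set" where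
  "local_observables N D j =
     {tensor_at N D j X (1\<^sub>m (rest_dim N D j)) | X.
        X \<in> traceless_hermitian (D j) \<and> mtrace (X * X) = 1}"

definition deviation :: "complex mat \<Rightarrow> complex mat \<Rightarrow> complex mat \<Rightarrow> real" where
  "deviation \<rho> P X = (expect \<rho> X - expect (post_state \<rho> P) X)\<^sup>2"

text \<open>
  \<open>GREATEST\<close> denotes a genuine maximum: it is unspecified when no maximum is attained.
\<close>

definition local_disturbance ::
    "nat \<Rightarrow> (nat \<Rightarrow> nat) \<Rightarrow> nat \<Rightarrow> complex mat set \<Rightarrow> complex mat \<Rightarrow> real" where
  "local_disturbance N D j M \<rho> =
     (\<Sum>P\<in>M. if expect \<rho> P = 0 then 0
       else expect \<rho> P * (GREATEST x. x \<in> deviation \<rho> P ` local_observables N D j))"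

definition general_entanglement ::
    "nat \<Rightarrow> (nat \<Rightarrow> nat) \<Rightarrow> complex mat \<Rightarrow> real" where
  "general_entanglement N D \<rho> =
     (1 / real N) * (\<Sum>j\<in>{1..N}. inverse (1 - 1 / real (D j)) *
       (GREATEST x. x \<in> (\<lambda>M. local_disturbance N D j M \<rho>) ` rest_measurements N D j))"

definition local_expect ::
    "nat \<Rightarrow> (nat \<Rightarrow> nat) \<Rightarrow> nat \<Rightarrow> complex mat \<Rightarrow> complex mat \<Rightarrow> real" where
  "local_expect N D j \<rho> X = expect \<rho> (tensor_at N D j X (1\<^sub>m (rest_dim N D j)))"

end

theory Submission
  imports Defs
begin

text \<open>
  Let \<open>R\<close> be the reduced state of party \<open>j\<close>. The outcome \<open>\<chi>\<close> leaves party \<open>j\<close> in the pure state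
  \<open>K\<^sub>\<chi> / p\<^sub>\<chi>\<close>, where \<open>K\<^sub>\<chi>\<close> is the projector onto the unnormalized vector \<open>\<langle>\<chi>|\<psi>\<rangle>\<close>. By Cauchy--Schwarz
  for the trace inner product, the maximum over the normalized traceless observables is
  \<open>Tr ((R - K\<^sub>\<chi> / p\<^sub>\<chi>)\<^sup>2)\<close>, so that the outcome contributes \<open>p\<^sub>\<chi> Tr (R\<^sup>2) - 2 Tr (R K\<^sub>\<chi>) + p\<^sub>\<chi>\<close>.
  Completeness of the measured basis gives \<open>\<Sum>\<^sub>\<chi> K\<^sub>\<chi> = R\<close>, and the contributions add up to
  \<open>1 - Tr (R\<^sup>2)\<close> whatever the basis. Parseval's identity for the traceless matrix \<open>R - 1/D\<close>
  turns \<open>Tr (R\<^sup>2)\<close> into \<open>1/D\<close> plus the sum of the squared expectation values.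
\<close>

section \<open>The Hilbert--Schmidt geometry of Hermitian matrices\<close>

lemma index_mult_mat_sum:
  assumes "A \<in> carrier_mat n m" "B \<in> carrier_mat m l" "i < n" "k < l"
  shows "(A * B) $$ (i, k) = (\<Sum>e<m. A $$ (i, e) * B $$ (e, k))"
  using assms by (simp add: scalar_prod_def atLeast0LessThan)

lemma mtrace_mult:
  assumes "A \<in> carrier_mat n m" "B \<in> carrier_mat m n"
  shows "mtrace (A * B) = (\<Sum>i<n. \<Sum>k<m. A $$ (i, k) * B $$ (k, i))"
  using assms by (auto simp: mtrace_def scalar_prod_def atLeast0LessThan intro!: sum.cong)

lemma mtrace_mult_commute:
  assumes "A \<in> carrier_mat n m" "B \<in> carrier_mat m n"
  shows "mtrace (A * B) = mtrace (B * A)"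
  unfolding mtrace_mult[OF assms] mtrace_mult[OF assms(2,1)]
  by (subst sum.swap) (simp add: mult.commute)

lemma mtrace_smult_mult:
  assumes "A \<in> carrier_mat n n" "X \<in> carrier_mat n n"
  shows "mtrace ((c \<cdot>\<^sub>m A) * X) = c * mtrace (A * X)"
  using assms by (simp add: mtrace_mult[of _ n n] sum_distrib_left mult.assoc)

lemma mtrace_minus_smult_mult:
  assumes "A \<in> carrier_mat n n" "B \<in> carrier_mat n n" "X \<in> carrier_mat n n"
  shows "mtrace ((A - c \<cdot>\<^sub>m B) * X) = mtrace (A * X) - c * mtrace (B * X)"
proof -
  have C: "A - c \<cdot>\<^sub>m B \<in> carrier_mat n n"
    using assms by (intro minus_carrier_mat smult_carrier_mat)
  show ?thesis
    unfolding mtrace_mult[OF C assms(3)] mtrace_mult[OF assms(1,3)] mtrace_mult[OF assms(2,3)]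
    using assms by (simp add: sum_distrib_left sum_subtractf left_diff_distrib mult.assoc)
qed

lemma mtrace_minus_smult:
  assumes "A \<in> carrier_mat n n" "B \<in> carrier_mat n n"
  shows "mtrace (A - c \<cdot>\<^sub>m B) = mtrace A - c * mtrace B"
  using assms by (simp add: mtrace_def sum_distrib_left sum_subtractf)

text \<open>The trace form is bilinear and both cross terms agree by
  \<open>mtrace_mult_commute\<close>. It serves three purposes: Cauchy--Schwarz, the change of the
  reduced state caused by an outcome, and the subtraction of the maximally mixed state.\<close>

lemma mtrace_square_minus_smult:
  assumes "A \<in> carrier_mat n n" "B \<in> carrier_mat n n"
  shows "mtrace ((A - c \<cdot>\<^sub>m B) * (A - c \<cdot>\<^sub>m B)) =
    mtrace (A * A) - 2 * c * mtrace (A * B) + c\<^sup>2 * mtrace (B * B)"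
proof -
  have C: "A - c \<cdot>\<^sub>m B \<in> carrier_mat n n"
    using assms by (intro minus_carrier_mat smult_carrier_mat)
  have "mtrace (A * (A - c \<cdot>\<^sub>m B)) = mtrace (A * A) - c * mtrace (A * B)"
    using assms C mtrace_mult_commute[OF assms(1) C] mtrace_mult_commute[OF assms]
    by (simp add: mtrace_minus_smult_mult)
  moreover have "mtrace (B * (A - c \<cdot>\<^sub>m B)) = mtrace (A * B) - c * mtrace (B * B)"
    using assms C mtrace_mult_commute[OF assms(2) C]
    by (simp add: mtrace_minus_smult_mult)
  ultimately show ?thesis
    unfolding mtrace_minus_smult_mult[OF assms C] by (simp add: power2_eq_square ring_distribs)
qed

section \<open>Hermitian matrices described by their entries\<close>

lemma mat_adjoint_eq_self_iff:
  assumes "A \<in> carrier_mat n n"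
  shows "mat_adjoint A = A \<longleftrightarrow> (\<forall>s<n. \<forall>t<n. A $$ (t, s) = cnj (A $$ (s, t)))"
proof -
  have "mat_adjoint A = mat n n (\<lambda>(s, t). cnj (A $$ (t, s)))"
    using assms by (intro eq_matI) (auto simp: mat_adjoint_def mat_of_rows_def)
  then have "mat_adjoint A = A \<longleftrightarrow> (\<forall>t<n. \<forall>s<n. cnj (A $$ (s, t)) = A $$ (t, s))"
    using assms by (simp add: mat_eq_iff)
  then show ?thesis by metis
qed

lemma traceless_hermitianI:
  assumes "A \<in> carrier_mat n n" "\<And>s t. s < n \<Longrightarrow> t < n \<Longrightarrow> A $$ (t, s) = cnj (A $$ (s, t))"
    and "mtrace A = 0"
  shows "A \<in> traceless_hermitian n"
  unfolding traceless_hermitian_def using assms(1,3) mat_adjoint_eq_self_iff[OF assms(1)] assms(2)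
  by blast

lemma traceless_hermitianD:
  assumes "A \<in> traceless_hermitian n"
  shows "A \<in> carrier_mat n n"
    and "s < n \<Longrightarrow> t < n \<Longrightarrow> A $$ (t, s) = cnj (A $$ (s, t))"
    and "mtrace A = 0"
proof -
  show A: "A \<in> carrier_mat n n" and "mtrace A = 0"
    using assms by (simp_all add: traceless_hermitian_def)
  show "s < n \<Longrightarrow> t < n \<Longrightarrow> A $$ (t, s) = cnj (A $$ (s, t))"
    using assms mat_adjoint_eq_self_iff[OF A] unfolding traceless_hermitian_def by blast
qed

text \<open>Opposite entries are conjugate, so the trace of the square is the squared Frobenius
  norm. This is the source of positivity for the trace form.\<close>

lemma mtrace_square_hermitian:
  assumes "A \<in> carrier_mat n n" "\<And>s t. s < n \<Longrightarrow> t < n \<Longrightarrow> A $$ (t, s) = cnj (A $$ (s, t))"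
  shows "mtrace (A * A) = of_real (\<Sum>s<n. \<Sum>t<n. (cmod (A $$ (s, t)))\<^sup>2)"
proof -
  have "A $$ (s, t) * A $$ (t, s) = of_real ((cmod (A $$ (s, t)))\<^sup>2)" if "s < n" "t < n" for s t
    using assms(2)[OF that] complex_norm_square by simp
  then show ?thesis
    unfolding mtrace_mult[OF assms(1,1)] of_real_sum by (intro sum.cong) auto
qed

text \<open>Cauchy--Schwarz against the unit vector \<open>X\<close>: the remainder of
  \<open>B\<close> after removing its component along \<open>X\<close> has nonnegative squared
  norm.\<close>

lemma Re_mtrace_mult_square_le:
  assumes B: "B \<in> traceless_hermitian n" and X: "X \<in> traceless_hermitian n" "mtrace (X * X) = 1"
  shows "(Re (mtrace (B * X)))\<^sup>2 \<le> Re (mtrace (B * B))"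
proof -
  \<comment> \<open>With the projection coefficient \<open>c\<close>, the cross term contributes
    \<open>- 2 * c\<^sup>2\<close> and the square of the subtracted part
    \<open>c\<^sup>2\<close>.\<close>
  define c where "c = Re (mtrace (B * X))"
  let ?Y = "B - of_real c \<cdot>\<^sub>m X"
  have [simp]: "B \<in> carrier_mat n n" "X \<in> carrier_mat n n"
    using assms traceless_hermitianD(1) by auto
  have [simp]: "?Y \<in> carrier_mat n n"
    by (intro minus_carrier_mat smult_carrier_mat) simp
  have herm: "?Y $$ (t, s) = cnj (?Y $$ (s, t))" if "s < n" "t < n" for s t
    using traceless_hermitianD(2)[OF B that] traceless_hermitianD(2)[OF X(1) that] that
    by (simp add: carrier_matD[of X n n])
  have "mtrace (?Y * ?Y) = of_real (\<Sum>s<n. \<Sum>t<n. (cmod (?Y $$ (s, t)))\<^sup>2)"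
    by (rule mtrace_square_hermitian) (simp, rule herm)
  then have "0 \<le> Re (mtrace (?Y * ?Y))"
    unfolding Re_complex_of_real by (simp only: Re_complex_of_real) (intro sum_nonneg, simp)
  also have "Re (mtrace (?Y * ?Y)) = Re (mtrace (B * B)) - c\<^sup>2"
    using X(2)
    by (subst mtrace_square_minus_smult[of _ n])
       (simp_all flip: of_real_power add: c_def[symmetric] power2_eq_square)
  finally show ?thesis by (simp add: c_def)
qed

text \<open>The Cauchy--Schwarz bound is attained at \<open>B\<close> divided by its norm. If
  \<open>B\<close> has norm zero there is nothing to normalize, and \<open>X0\<close> supplies an
  admissible point at which the value is 0.\<close>

lemma Greatest_Re_mtrace_mult_square:
  assumes B: "B \<in> traceless_hermitian n"
    and X0: "X0 \<in> traceless_hermitian n" "mtrace (X0 * X0) = 1"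
  shows "(GREATEST x. x \<in> (\<lambda>X. (Re (mtrace (B * X)))\<^sup>2) `
            {X \<in> traceless_hermitian n. mtrace (X * X) = 1}) = Re (mtrace (B * B))"
proof (rule Greatest_equality)
  have Bc[simp]: "B \<in> carrier_mat n n" using B by (rule traceless_hermitianD)
  define b where "b = (\<Sum>s<n. \<Sum>t<n. (cmod (B $$ (s, t)))\<^sup>2)"
  have trB: "mtrace (B * B) = of_real b"
    unfolding b_def using Bc traceless_hermitianD(2)[OF B] by (rule mtrace_square_hermitian)
  have b0: "b \<ge> 0" unfolding b_def by (intro sum_nonneg) auto
  show "Re (mtrace (B * B)) \<in> (\<lambda>X. (Re (mtrace (B * X)))\<^sup>2) `
            {X \<in> traceless_hermitian n. mtrace (X * X) = 1}"
  proof (cases "b = 0")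
    case True
    then have "(Re (mtrace (B * X0)))\<^sup>2 = 0"
      using Re_mtrace_mult_square_le[OF B X0] trB by (intro order_antisym) simp_all
    then show ?thesis
      using X0 trB True by (intro image_eqI[of _ _ X0]) auto
  next
    case False
    \<comment> \<open>\<open>b\<close> is the squared norm of \<open>B\<close>, so this is
      \<open>B\<close> rescaled to norm 1.\<close>
    define X where "X = complex_of_real (1 / sqrt b) \<cdot>\<^sub>m B"
    have Xc[simp]: "X \<in> carrier_mat n n" by (simp add: X_def)
    have BX: "mtrace (B * X) = of_real (1 / sqrt b) * of_real b"
      unfolding X_def trB[symmetric]
      by (simp add: mtrace_mult[of _ n n] carrier_matD[OF Bc] sum_distrib_left algebra_simps)
    have XX: "mtrace (X * X) = of_real (1 / sqrt b) * (of_real (1 / sqrt b) * of_real b)"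
      unfolding X_def trB[symmetric]
      by (simp add: mtrace_mult[of _ n n] carrier_matD[OF Bc] sum_distrib_left algebra_simps)
    have "mtrace (X * X) = 1"
      unfolding XX of_real_mult[symmetric] using False b0 by simp
    moreover have "X \<in> traceless_hermitian n"
    proof (rule traceless_hermitianI)
      show "X $$ (t, s) = cnj (X $$ (s, t))" if "s < n" "t < n" for s t
        using traceless_hermitianD(2)[OF B that] that by (simp add: X_def carrier_matD[OF Bc])
      have "mtrace X = of_real (1 / sqrt b) * mtrace B"
        by (simp add: X_def mtrace_def sum_distrib_left carrier_matD[OF Bc])
      then show "mtrace X = 0" using traceless_hermitianD(3)[OF B] by simp
    qed simp
    moreover have "(Re (mtrace (B * X)))\<^sup>2 = b"
      unfolding BX of_real_mult[symmetric] using False b0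
      by (simp add: power_divide power2_eq_square)
    ultimately show ?thesis
      using trB by (intro image_eqI[of _ _ X]) auto
  qed
qed (use Re_mtrace_mult_square_le[OF B] in auto)

text \<open>Orthonormality identifies the coefficients of \<open>B\<close> with its traces against
  the basis; expanding one factor of \<open>B * B\<close> then turns the other into the same
  coefficients.\<close>

lemma traceless_onb_Parseval:
  assumes A: "traceless_onb n A" and B: "B \<in> traceless_hermitian n"
  shows "Re (mtrace (B * B)) = (\<Sum>k\<in>{1..n\<^sup>2 - 1}. (Re (mtrace (B * A k)))\<^sup>2)"
proof -
  let ?K = "{1..n\<^sup>2 - 1}"
  have Bc: "B \<in> carrier_mat n n" using B by (rule traceless_hermitianD)
  have Ac: "A k \<in> carrier_mat n n" if "k \<in> ?K" for k
    using A that traceless_hermitianD(1) by (auto simp: traceless_onb_def)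
  obtain c :: "nat \<Rightarrow> real"
    where c: "B = mat n n (\<lambda>(s, t). \<Sum>k\<in>?K. of_real (c k) * A k $$ (s, t))"
    using A B unfolding traceless_onb_def by blast
  \<comment> \<open>Linearity in the first factor, used once with \<open>X = A l\<close> to read off
    a coefficient and once with \<open>X = B\<close>.\<close>
  have expand: "mtrace (B * X) = (\<Sum>k\<in>?K. of_real (c k) * mtrace (A k * X))"
    if X: "X \<in> carrier_mat n n" for X
  proof -
    have "mtrace (B * X) = (\<Sum>i<n. \<Sum>l<n. \<Sum>k\<in>?K. of_real (c k) * A k $$ (i, l) * X $$ (l, i))"
      unfolding mtrace_mult[OF Bc X] by (auto simp: c sum_distrib_right intro!: sum.cong)
    also have "\<dots> = (\<Sum>k\<in>?K. \<Sum>i<n. \<Sum>l<n. of_real (c k) * A k $$ (i, l) * X $$ (l, i))"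
      by (subst sum.swap[of _ "{..<n}" ?K]) (intro sum.cong refl sum.swap)
    also have "\<dots> = (\<Sum>k\<in>?K. of_real (c k) * mtrace (A k * X))"
      using mtrace_mult[OF Ac X] by (auto simp: sum_distrib_left algebra_simps intro!: sum.cong)
    finally show ?thesis .
  qed
  have coeff: "mtrace (B * A l) = of_real (c l)" if l: "l \<in> ?K" for l
  proof -
    have "mtrace (B * A l) = (\<Sum>k\<in>?K. if k = l then of_real (c k) else 0)"
      unfolding expand[OF Ac[OF l]] using A l
      by (intro sum.cong) (auto simp: traceless_onb_def)
    then show ?thesis using l by simp
  qed
  have "mtrace (B * B) = (\<Sum>k\<in>?K. of_real (c k) * of_real (c k))"
    unfolding expand[OF Bc] using mtrace_mult_commute[OF Ac Bc] coeff
    by (intro sum.cong) auto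
  then show ?thesis
    using coeff by (simp add: power2_eq_square)
qed

section \<open>Orthonormal bases\<close>

text \<open>With the basis vectors as columns of \<open>Q\<close>, orthonormality says
  \<open>Q' * Q = 1\<close> and completeness says \<open>Q * Q' = 1\<close>. For square matrices a
  left inverse is also a right inverse.\<close>

lemma orthonormal_basis_completeness:
  assumes S: "orthonormal_basis n S"
  shows "finite S" "S \<subseteq> carrier_vec n"
    and "\<And>a b. a < n \<Longrightarrow> b < n \<Longrightarrow> (\<Sum>\<chi>\<in>S. \<chi> $ a * cnj (\<chi> $ b)) = (if a = b then 1 else 0)"
proof -
  interpret vec_space "TYPE(complex)" n .
  have basis: "basis S" and on: "\<And>u v. u \<in> S \<Longrightarrow> v \<in> S \<Longrightarrow> u \<bullet>c v = (if u = v then 1 else 0)"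
    using S by (auto simp: orthonormal_basis_def)
  show fin: "finite S"
    using basis fin_dim_li_fin[OF fin_dim] by (auto simp: basis_def)
  show Sc: "S \<subseteq> carrier_vec n"
    using basis by (auto simp: basis_def)
  \<comment> \<open>The cardinality is what makes \<open>Q\<close> square.\<close>
  have card: "card S = n"
    using dim_basis[OF fin basis] dim_is_n by simp
  obtain e where e: "bij_betw e {..<n} S"
    using fin card ex_bij_betw_nat_finite[of S] by (auto simp: atLeast0LessThan)
  have eS: "e i \<in> S" "e i \<in> carrier_vec n" if "i < n" for i
    using e that Sc by (auto simp: bij_betw_def)
  have einj: "e i = e k \<longleftrightarrow> i = k" if "i < n" "k < n" for i k
    using e that by (auto simp: bij_betw_def inj_on_def)
  define Q where "Q = mat n n (\<lambda>(a, i). e i $ a)"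
  define Q' where "Q' = mat n n (\<lambda>(i, a). cnj (e i $ a))"
  have "Q' * Q = 1\<^sub>m n"
  proof (intro eq_matI)
    fix i k assume "i < dim_row (1\<^sub>m n)" "k < dim_col (1\<^sub>m n)"
    then have ik: "i < n" "k < n" by auto
    then have "(Q' * Q) $$ (i, k) = e k \<bullet>c e i"
      using eS[OF ik(1)] eS[OF ik(2)]
      by (auto simp: Q_def Q'_def scalar_prod_def intro!: sum.cong)
    then show "(Q' * Q) $$ (i, k) = 1\<^sub>m n $$ (i, k)"
      using on[OF eS(1) eS(1), of k i] einj ik by auto
  qed (auto simp: Q_def Q'_def)
  then have QQ: "Q * Q' = 1\<^sub>m n"
    by (intro mat_mult_left_right_inverse[of Q' n Q]) (auto simp: Q_def Q'_def)
  fix a b assume ab: "a < n" "b < n"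
  have "(\<Sum>\<chi>\<in>S. \<chi> $ a * cnj (\<chi> $ b)) = (\<Sum>i<n. e i $ a * cnj (e i $ b))"
    using sum.reindex_bij_betw[OF e, of "\<lambda>\<chi>. \<chi> $ a * cnj (\<chi> $ b)"] by simp
  also have "\<dots> = (Q * Q') $$ (a, b)"
    using ab by (auto simp: Q_def Q'_def scalar_prod_def intro!: sum.cong)
  finally show "(\<Sum>\<chi>\<in>S. \<chi> $ a * cnj (\<chi> $ b)) = (if a = b then 1 else 0)"
    using ab by (simp add: QQ)
qed

text \<open>Exhibits one measurement basis, so that the maximum over measurements ranges over a
  nonempty set.\<close>

lemma orthonormal_basis_unit_vecs: "orthonormal_basis n (set (unit_vecs n))"
proof -
  interpret vec_space "TYPE(complex)" n .
  have "u \<bullet>c v = (if u = v then 1 else 0)"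
    if uv: "u \<in> set (unit_vecs n)" "v \<in> set (unit_vecs n)" for u v :: "complex vec"
  proof -
    obtain i k where ik: "i < n" "k < n" "u = unit_vec n i" "v = unit_vec n k"
      using uv by (auto simp: unit_vecs_def)
    have "u \<bullet>c v = (\<Sum>l<n. (if l = i then 1 else 0) * cnj (if l = k then 1 else 0))"
      using ik by (auto simp: scalar_prod_def unit_vec_def atLeast0LessThan intro!: sum.cong)
    also have "\<dots> = (\<Sum>l<n. if l = i then (if i = k then 1 else 0) else 0)"
      by (intro sum.cong) auto
    also have "\<dots> = (if i = k then 1 else 0)" using ik by simp
    finally show ?thesis using ik by (auto simp: unit_vec_eq)
  qed
  then show ?thesis
    using unit_vecs_basis by (auto simp: orthonormal_basis_def)
qed

text \<open>Applied to \<open>u\<close>, the projector onto \<open>u\<close> returns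
  \<open>u\<close>, whereas the projector onto a different basis vector returns 0. Equal projectors
  would force \<open>u = 0\<close>.\<close>

lemma inj_on_ket_bra_orthonormal:
  assumes "orthonormal_basis n S"
  shows "inj_on ket_bra S"
proof (rule inj_onI, rule ccontr)
  fix u v assume uv: "u \<in> S" "v \<in> S" "ket_bra u = ket_bra v" "u \<noteq> v"
  have on: "u \<bullet>c u = 1"
    using assms uv by (auto simp: orthonormal_basis_def)
  have c: "u \<in> carrier_vec n" "v \<in> carrier_vec n"
    using uv orthonormal_basis_completeness(2)[OF assms] by auto
  have "u $ a * cnj (u $ b) = v $ a * cnj (v $ b)" if "a < n" "b < n" for a b
    using arg_cong[OF uv(3), of "\<lambda>M. M $$ (a, b)"] c that by (simp add: ket_bra_def)
  then have "(\<Sum>b<n. u $ a * cnj (u $ b) * u $ b) = (\<Sum>b<n. v $ a * cnj (v $ b) * u $ b)" if "a < n" for a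
    using that by (intro sum.cong) auto
  moreover have "(\<Sum>b<n. w $ a * cnj (w $ b) * u $ b) = w $ a * (u \<bullet>c w)" if "w \<in> carrier_vec n" for a w
    using that c by (auto simp: scalar_prod_def sum_distrib_left atLeast0LessThan algebra_simps intro!: sum.cong)
  moreover have "u \<bullet>c v = 0"
    using assms uv by (auto simp: orthonormal_basis_def)
  ultimately have "u $ a = 0" if "a < n" for a
    using that c on by auto
  then have "u \<bullet>c u = 0" using c by (simp add: scalar_prod_def)
  then show False using on by simp
qed

section \<open>Singling out one tensor factor\<close>

locale party =
  fixes N :: nat and D :: "nat \<Rightarrow> nat" and j :: nat
  assumes party: "j \<in> {1..N}" and dim_pos: "\<And>k. k \<in> {1..N} \<Longrightarrow> D k > 0"
begin

text \<open>The factors before \<open>j\<close> hold the most significant digits; this is the number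
  of values of the part of an index above digit \<open>j\<close>, as \<open>place N D j\<close> is
  for the part below it.\<close>

definition prefix_dim :: nat where
  "prefix_dim = (\<Prod>k\<in>{1..<j}. D k)"

lemma place_pos: "place N D j > 0"
  unfolding place_def using party by (intro prod_pos ballI dim_pos) auto

lemma D_pos: "D j > 0"
  using dim_pos party .

lemma rest_dim_eq: "rest_dim N D j = prefix_dim * place N D j"
proof -
  have *: "{1..N} - {j} = {1..<j} \<union> {j<..N}" using party by auto
  show ?thesis
    unfolding rest_dim_def prefix_dim_def place_def * by (rule prod.union_disjoint) auto
qed

lemma total_dim_eq: "total_dim N D = prefix_dim * (place N D j * D j)"
proof -
  have "total_dim N D = D j * rest_dim N D j"
    unfolding total_dim_def rest_dim_def using party by (subst prod.remove[of _ j]) auto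
  then show ?thesis by (simp add: rest_dim_eq)
qed

lemma digit_less: "digit N D j a < D j"
  by (simp add: digit_def D_pos)

lemma del_digit_less:
  assumes "a < total_dim N D"
  shows "del_digit N D j a < rest_dim N D j"
proof -
  let ?w = "place N D j"
  have "a div (?w * D j) < prefix_dim"
    using assms by (simp add: total_dim_eq less_mult_imp_div_less)
  \<comment> \<open>Passing to the successor of the high part leaves room for the low part, which is
    smaller than the weight \<open>place N D j\<close>.\<close>
  then have "Suc (a div (?w * D j)) * ?w \<le> prefix_dim * ?w"
    by (intro mult_le_mono1) simp
  then show ?thesis
    using mod_less_divisor[OF place_pos, of a] by (simp add: del_digit_def rest_dim_eq)
qed

lemma ins_digit_less:
  assumes "s < D j" "r < rest_dim N D j"
  shows "ins_digit N D j s r < total_dim N D"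
proof -
  let ?w = "place N D j"
  have "r div ?w < prefix_dim"
    using assms by (simp add: rest_dim_eq less_mult_imp_div_less)
  then have "Suc (r div ?w) * D j \<le> prefix_dim * D j"
    by (intro mult_le_mono1) simp
  then have "Suc (r div ?w * D j + s) \<le> prefix_dim * D j"
    using assms by simp
  then have "Suc (r div ?w * D j + s) * ?w \<le> prefix_dim * D j * ?w"
    by (rule mult_le_mono1)
  then show ?thesis
    using mod_less_divisor[OF place_pos, of r]
    by (simp add: ins_digit_def total_dim_eq algebra_simps)
qed

text \<open>Euclidean division by the weight of position \<open>j\<close> separates the inserted
  digit from the lower part, and a digit below \<open>D j\<close> causes no carry into the higher
  part.\<close>

lemma
  assumes "s < D j"
  shows digit_ins_digit: "digit N D j (ins_digit N D j s r) = s"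
    and del_digit_ins_digit: "del_digit N D j (ins_digit N D j s r) = r"
proof -
  let ?w = "place N D j" and ?a = "ins_digit N D j s r"
  have dw: "?a div ?w = r div ?w * D j + s"
    using place_pos by (simp add: ins_digit_def)
  then show "digit N D j ?a = s"
    using assms by (simp add: digit_def)
  have "?a div (?w * D j) = r div ?w"
    using assms dw by (simp add: div_mult2_eq)
  moreover have "?a mod ?w = r mod ?w"
    by (simp add: ins_digit_def)
  ultimately show "del_digit N D j ?a = r"
    by (simp add: del_digit_def)
qed

lemma ins_digit_digit_del_digit: "ins_digit N D j (digit N D j a) (del_digit N D j a) = a"
proof -
  let ?w = "place N D j" and ?r = "del_digit N D j a"
  have "?r div ?w = a div ?w div D j" "?r mod ?w = a mod ?w"
    using place_pos by (simp_all add: del_digit_def div_mult2_eq)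
  then show ?thesis
    by (simp only: ins_digit_def digit_def div_mult_mod_eq)
qed

text \<open>Deleting and inserting digit \<open>j\<close> are inverse bijections between the indices
  of the whole space and pairs of indices. This is the identification of the space with (factor
  \<open>j\<close>) tensor (rest) in the form needed for traces.\<close>

lemma sum_total_dim:
  fixes f :: "nat \<Rightarrow> 'b :: comm_monoid_add"
  shows "(\<Sum>a<total_dim N D. f a) = (\<Sum>s<D j. \<Sum>r<rest_dim N D j. f (ins_digit N D j s r))"
  unfolding sum.cartesian_product
  by (rule sum.reindex_bij_witness[of _ "\<lambda>(s, r). ins_digit N D j s r"
        "\<lambda>a. (digit N D j a, del_digit N D j a)"])
    (auto simp: ins_digit_less digit_less del_digit_less digit_ins_digit del_digit_ins_digit
      ins_digit_digit_del_digit)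

end

section \<open>Rank-one operators\<close>

lemma ket_bra_carrier: "v \<in> carrier_vec n \<Longrightarrow> ket_bra v \<in> carrier_mat n n"
  by (simp add: ket_bra_def)

lemma ket_bra_index:
  "v \<in> carrier_vec n \<Longrightarrow> a < n \<Longrightarrow> b < n \<Longrightarrow> ket_bra v $$ (a, b) = v $ a * cnj (v $ b)"
  by (simp add: ket_bra_def)

lemma mtrace_ket_bra: "mtrace (ket_bra v) = v \<bullet>c v"
  by (simp add: mtrace_def ket_bra_def scalar_prod_def atLeast0LessThan)

lemma cscalar_prod_self: "v \<bullet>c v = of_real (\<Sum>i<dim_vec v. (cmod (v $ i))\<^sup>2)"
  by (simp add: scalar_prod_def atLeast0LessThan flip: complex_norm_square)

lemma mtrace_ket_bra_square:
  assumes "v \<in> carrier_vec n"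
  shows "mtrace (ket_bra v * ket_bra v) = (v \<bullet>c v)\<^sup>2"
proof -
  have "mtrace (ket_bra v * ket_bra v) =
      (\<Sum>i<n. \<Sum>k<n. (v $ i * cnj (v $ i)) * (v $ k * cnj (v $ k)))"
    using assms by (simp add: mtrace_mult[OF ket_bra_carrier ket_bra_carrier] ket_bra_index algebra_simps)
  also have "\<dots> = (v \<bullet>c v)\<^sup>2"
    using assms by (simp add: sum_product power2_eq_square scalar_prod_def atLeast0LessThan)
  finally show ?thesis .
qed

section \<open>Partial traces and the collapse under a measurement of the rest\<close>

context party
begin

text \<open>The partial inner product \<open>\<langle>\<chi>|v\<rangle>\<close>: the unnormalized state in which the outcome \<open>\<chi>\<close> leaves
  party \<open>j\<close>.\<close>

definition conditional_vec :: "complex vec \<Rightarrow> complex vec \<Rightarrow> complex vec" where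
  "conditional_vec v \<chi> = vec (D j) (\<lambda>s. \<Sum>r<rest_dim N D j. v $ ins_digit N D j s r * cnj (\<chi> $ r))"

lemma conditional_vec_carrier[simp]: "conditional_vec v \<chi> \<in> carrier_vec (D j)"
  by (simp add: conditional_vec_def)

lemma reduced_state_carrier[simp]: "reduced_state N D j M \<in> carrier_mat (D j) (D j)"
  by (simp add: reduced_state_def)

lemma tensor_at_carrier[simp]: "tensor_at N D j X Y \<in> carrier_mat (total_dim N D) (total_dim N D)"
  by (simp add: tensor_at_def)

lemma tensor_at_ins_digit:
  assumes "s < D j" "r < rest_dim N D j" "t < D j" "u < rest_dim N D j"
  shows "tensor_at N D j X Y $$ (ins_digit N D j s r, ins_digit N D j t u) = X $$ (s, t) * Y $$ (r, u)"
  using assms by (simp add: tensor_at_def ins_digit_less digit_ins_digit del_digit_ins_digit)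

lemma reduced_state_ket_bra_index:
  assumes "v \<in> carrier_vec (total_dim N D)" "s < D j" "t < D j"
  shows "reduced_state N D j (ket_bra v) $$ (s, t) =
    (\<Sum>r<rest_dim N D j. v $ ins_digit N D j s r * cnj (v $ ins_digit N D j t r))"
  using assms by (simp add: reduced_state_def ket_bra_def ins_digit_less)

text \<open>Common starting point for expectation values of local observables, where
  \<open>Y\<close> is the identity, and for outcome probabilities, where \<open>X\<close> is the
  identity.\<close>

lemma mtrace_ket_bra_tensor_at:
  assumes "v \<in> carrier_vec (total_dim N D)"
  shows "mtrace (ket_bra v * tensor_at N D j X Y) =
    (\<Sum>s<D j. \<Sum>r<rest_dim N D j. \<Sum>t<D j. \<Sum>u<rest_dim N D j.
      v $ ins_digit N D j s r * cnj (v $ ins_digit N D j t u) * (X $$ (t, s) * Y $$ (u, r)))"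
  unfolding mtrace_mult[OF ket_bra_carrier[OF assms] tensor_at_carrier] sum_total_dim
  using assms
  by (intro sum.cong refl) (simp add: ket_bra_index tensor_at_ins_digit ins_digit_less)

text \<open>The characteristic property of the partial trace: the identity on the rest forces
  \<open>u = r\<close>, and summing over \<open>r\<close> yields the entries of the reduced
  state.\<close>

lemma mtrace_local_observable:
  assumes v: "v \<in> carrier_vec (total_dim N D)" and X: "X \<in> carrier_mat (D j) (D j)"
  shows "mtrace (ket_bra v * tensor_at N D j X (1\<^sub>m (rest_dim N D j))) =
    mtrace (reduced_state N D j (ket_bra v) * X)"
proof -
  let ?m = "rest_dim N D j" and ?v = "\<lambda>s r. v $ ins_digit N D j s r"
  have "mtrace (ket_bra v * tensor_at N D j X (1\<^sub>m ?m)) =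
      (\<Sum>s<D j. \<Sum>r<?m. \<Sum>t<D j. \<Sum>u<?m. if u = r then ?v s r * cnj (?v t r) * X $$ (t, s) else 0)"
    unfolding mtrace_ket_bra_tensor_at[OF v] by (intro sum.cong refl) auto
  also have "\<dots> = (\<Sum>s<D j. \<Sum>r<?m. \<Sum>t<D j. ?v s r * cnj (?v t r) * X $$ (t, s))"
    by (intro sum.cong refl) simp
  also have "\<dots> = (\<Sum>s<D j. \<Sum>t<D j. \<Sum>r<?m. ?v s r * cnj (?v t r) * X $$ (t, s))"
    by (intro sum.cong refl sum.swap)
  also have "\<dots> = mtrace (reduced_state N D j (ket_bra v) * X)"
    unfolding mtrace_mult[OF reduced_state_carrier X]
    by (intro sum.cong refl) (simp add: reduced_state_ket_bra_index[OF v] sum_distrib_right)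
  finally show ?thesis .
qed

text \<open>The Born probability is the squared norm of the conditional vector: the identity on
  party \<open>j\<close> forces \<open>t = s\<close>, and the sums over \<open>r\<close> and
  \<open>u\<close> then factor.\<close>

lemma mtrace_rest_projection:
  assumes v: "v \<in> carrier_vec (total_dim N D)" and \<chi>: "\<chi> \<in> carrier_vec (rest_dim N D j)"
  shows "mtrace (ket_bra v * tensor_at N D j (1\<^sub>m (D j)) (ket_bra \<chi>)) =
    conditional_vec v \<chi> \<bullet>c conditional_vec v \<chi>"
proof -
  let ?m = "rest_dim N D j" and ?v = "\<lambda>s r. v $ ins_digit N D j s r"
  have "mtrace (ket_bra v * tensor_at N D j (1\<^sub>m (D j)) (ket_bra \<chi>)) =
      (\<Sum>s<D j. \<Sum>r<?m. \<Sum>t<D j. if t = s then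
         \<Sum>u<?m. (?v s r * cnj (\<chi> $ r)) * (cnj (?v s u) * \<chi> $ u) else 0)"
    unfolding mtrace_ket_bra_tensor_at[OF v]
    by (intro sum.cong refl) (auto simp: ket_bra_index[OF \<chi>] intro!: sum.cong)
  also have "\<dots> = (\<Sum>s<D j. \<Sum>r<?m. \<Sum>u<?m. (?v s r * cnj (\<chi> $ r)) * (cnj (?v s u) * \<chi> $ u))"
    by (rule sum.cong[OF refl], rule sum.cong[OF refl]) simp
  also have "\<dots> = conditional_vec v \<chi> \<bullet>c conditional_vec v \<chi>"
    by (simp add: conditional_vec_def scalar_prod_def sum_product atLeast0LessThan)
  finally show ?thesis .
qed

text \<open>In coordinates, the projection sends \<open>v\<close> to the product vector with factors
  \<open>conditional_vec v \<chi>\<close> and \<chi>.\<close>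

lemma tensor_at_rest_mult_vec:
  assumes \<chi>: "\<chi> \<in> carrier_vec (rest_dim N D j)" and a: "a < total_dim N D"
  shows "(\<Sum>c<total_dim N D. tensor_at N D j (1\<^sub>m (D j)) (ket_bra \<chi>) $$ (a, c) * v $ c) =
    conditional_vec v \<chi> $ digit N D j a * \<chi> $ del_digit N D j a"
proof -
  let ?m = "rest_dim N D j" and ?v = "\<lambda>s r. v $ ins_digit N D j s r"
  define t u where tu: "t = digit N D j a" "u = del_digit N D j a"
  have tu': "t < D j" "u < ?m" and a_eq: "a = ins_digit N D j t u"
    using digit_less del_digit_less[OF a] ins_digit_digit_del_digit by (simp_all add: tu)
  have "(\<Sum>c<total_dim N D. tensor_at N D j (1\<^sub>m (D j)) (ket_bra \<chi>) $$ (a, c) * v $ c) =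
      (\<Sum>s<D j. if s = t then \<Sum>r<?m. \<chi> $ u * (?v t r * cnj (\<chi> $ r)) else 0)"
    unfolding sum_total_dim a_eq using tu'
    by (intro sum.cong refl) (auto simp: tensor_at_ins_digit ket_bra_index[OF \<chi>] intro!: sum.cong)
  also have "\<dots> = conditional_vec v \<chi> $ t * \<chi> $ u"
    using tu' by (simp add: conditional_vec_def flip: sum_distrib_left)
  finally show ?thesis by (simp add: tu)
qed

text \<open>For Hermitian \<open>P\<close> the operator \<open>P |v><v| P\<close> is the rank-one
  operator of \<open>P v\<close>, and \<open>P v\<close> is the product vector
  \<open>w\<close>.\<close>

lemma collapse_ket_bra:
  assumes v: "v \<in> carrier_vec (total_dim N D)" and \<chi>: "\<chi> \<in> carrier_vec (rest_dim N D j)"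
  defines "P \<equiv> tensor_at N D j (1\<^sub>m (D j)) (ket_bra \<chi>)"
  defines "w \<equiv> vec (total_dim N D)
    (\<lambda>a. conditional_vec v \<chi> $ digit N D j a * \<chi> $ del_digit N D j a)"
  shows "P * ket_bra v * P = ket_bra w"
proof (rule eq_matI)
  let ?n = "total_dim N D"
  have Pc: "P \<in> carrier_mat ?n ?n" by (simp add: P_def)
  have kv: "ket_bra v \<in> carrier_mat ?n ?n" using ket_bra_carrier[OF v] .
  have wc: "w \<in> carrier_vec ?n" by (simp add: w_def)
  have Pv: "(\<Sum>c<?n. P $$ (a, c) * v $ c) = w $ a" if "a < ?n" for a
    using tensor_at_rest_mult_vec[OF \<chi> that] that by (simp add: P_def w_def)
  have Pherm: "P $$ (b, a) = cnj (P $$ (a, b))" if "a < ?n" "b < ?n" for a b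
    using that digit_less del_digit_less \<chi> by (simp add: P_def tensor_at_def ket_bra_index)
  fix a b assume "a < dim_row (ket_bra w)" "b < dim_col (ket_bra w)"
  then have ab: "a < ?n" "b < ?n" by (simp_all add: ket_bra_def w_def)
  have 1: "(P * ket_bra v) $$ (a, e) = w $ a * cnj (v $ e)" if "e < ?n" for e
  proof -
    have "(P * ket_bra v) $$ (a, e) = (\<Sum>c<?n. (P $$ (a, c) * v $ c) * cnj (v $ e))"
      using ab that Pc kv v by (simp add: scalar_prod_def ket_bra_index[OF v] atLeast0LessThan mult.assoc)
    then show ?thesis by (simp add: Pv[OF ab(1)] flip: sum_distrib_right)
  qed
  have "(P * ket_bra v * P) $$ (a, b) = (\<Sum>e<?n. (P * ket_bra v) $$ (a, e) * P $$ (e, b))"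
    using ab Pc kv by (intro index_mult_mat_sum) auto
  \<comment> \<open>Hermiticity of \<open>P\<close> moves the right-hand factor into the
    bra.\<close>
  also have "\<dots> = (\<Sum>e<?n. w $ a * cnj (P $$ (b, e) * v $ e))"
  proof (intro sum.cong refl)
    fix e assume "e \<in> {..<?n}"
    then have e: "e < ?n" by simp
    show "(P * ket_bra v) $$ (a, e) * P $$ (e, b) = w $ a * cnj (P $$ (b, e) * v $ e)"
      unfolding 1[OF e] Pherm[OF ab(2) e] by simp
  qed
  also have "\<dots> = w $ a * cnj (\<Sum>e<?n. P $$ (b, e) * v $ e)"
    by (simp only: sum_distrib_left cnj_sum)
  also have "\<dots> = ket_bra w $$ (a, b)"
    using ab by (simp add: Pv ket_bra_index[OF wc])
  finally show "(P * ket_bra v * P) $$ (a, b) = ket_bra w $$ (a, b)" .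
qed (simp_all add: P_def w_def ket_bra_def tensor_at_def)

text \<open>Tracing out the rest of a product vector only contributes the squared norm of \<chi>,
  which is 1.\<close>

lemma reduced_state_product:
  assumes \<phi>: "\<phi> \<in> carrier_vec (D j)" and \<chi>: "\<chi> \<in> carrier_vec (rest_dim N D j)" "\<chi> \<bullet>c \<chi> = 1"
  shows "reduced_state N D j (ket_bra (vec (total_dim N D)
    (\<lambda>a. \<phi> $ digit N D j a * \<chi> $ del_digit N D j a))) = ket_bra \<phi>" (is "reduced_state N D j (ket_bra ?w) = _")
proof (rule eq_matI)
  have wc: "?w \<in> carrier_vec (total_dim N D)" by simp
  fix s t assume "s < dim_row (ket_bra \<phi>)" "t < dim_col (ket_bra \<phi>)"
  then have st: "s < D j" "t < D j" using \<phi> by (simp_all add: ket_bra_def)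
  have "reduced_state N D j (ket_bra ?w) $$ (s, t) =
      (\<Sum>r<rest_dim N D j. (\<phi> $ s * cnj (\<phi> $ t)) * (\<chi> $ r * cnj (\<chi> $ r)))"
    unfolding reduced_state_ket_bra_index[OF wc st] using st
    by (intro sum.cong refl) (simp add: ins_digit_less digit_ins_digit del_digit_ins_digit)
  also have "\<dots> = (\<phi> $ s * cnj (\<phi> $ t)) * (\<chi> \<bullet>c \<chi>)"
    using \<chi>(1) by (simp add: scalar_prod_def atLeast0LessThan flip: sum_distrib_left)
  finally show "reduced_state N D j (ket_bra ?w) $$ (s, t) = ket_bra \<phi> $$ (s, t)"
    using st \<phi> \<chi>(2) by (simp add: ket_bra_index)
qed (use \<phi> in \<open>simp_all add: reduced_state_def ket_bra_def\<close>)

text \<open>Completeness replaces the sum over \<chi> by a Kronecker delta, leaving the partial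
  trace. This is where the dependence on the measured basis disappears.\<close>

lemma sum_conditional_ket_bra:
  assumes v: "v \<in> carrier_vec (total_dim N D)" and S: "orthonormal_basis (rest_dim N D j) S"
    and st: "s < D j" "t < D j"
  shows "(\<Sum>\<chi>\<in>S. ket_bra (conditional_vec v \<chi>) $$ (s, t)) = reduced_state N D j (ket_bra v) $$ (s, t)"
proof -
  let ?m = "rest_dim N D j" and ?v = "\<lambda>s r. v $ ins_digit N D j s r"
  have "(\<Sum>\<chi>\<in>S. ket_bra (conditional_vec v \<chi>) $$ (s, t)) =
      (\<Sum>\<chi>\<in>S. \<Sum>r<?m. \<Sum>u<?m. ?v s r * cnj (?v t u) * (\<chi> $ u * cnj (\<chi> $ r)))"
    using st
    by (intro sum.cong[OF refl], subst ket_bra_index[OF conditional_vec_carrier],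
        simp_all add: conditional_vec_def sum_product) (simp add: mult_ac)
  also have "\<dots> = (\<Sum>r<?m. \<Sum>u<?m. \<Sum>\<chi>\<in>S. ?v s r * cnj (?v t u) * (\<chi> $ u * cnj (\<chi> $ r)))"
    by (subst sum.swap[of _ "{..<?m}" S]) (intro sum.cong refl sum.swap)
  also have "\<dots> = (\<Sum>r<?m. \<Sum>u<?m. if u = r then ?v s r * cnj (?v t u) else 0)"
    using orthonormal_basis_completeness(3)[OF S]
    by (intro sum.cong refl) (simp flip: sum_distrib_left)
  also have "\<dots> = reduced_state N D j (ket_bra v) $$ (s, t)"
    by (simp add: reduced_state_ket_bra_index[OF v st])
  finally show ?thesis .
qed

end

section \<open>Disturbance by a measurement on the rest\<close>

context party
begin

lemma mtrace_reduced_state: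
  assumes v: "v \<in> carrier_vec (total_dim N D)"
  shows "mtrace (reduced_state N D j (ket_bra v)) = v \<bullet>c v"
proof -
  have "mtrace (reduced_state N D j (ket_bra v)) =
      (\<Sum>s<D j. reduced_state N D j (ket_bra v) $$ (s, s))"
    by (simp add: mtrace_def reduced_state_def)
  also have "\<dots> = (\<Sum>a<total_dim N D. v $ a * cnj (v $ a))"
    by (simp add: reduced_state_ket_bra_index[OF v] sum_total_dim)
  also have "\<dots> = v \<bullet>c v"
    using v by (simp add: scalar_prod_def atLeast0LessThan)
  finally show ?thesis .
qed

lemma reduced_state_hermitian:
  assumes "v \<in> carrier_vec (total_dim N D)" "s < D j" "t < D j"
  shows "reduced_state N D j (ket_bra v) $$ (t, s) = cnj (reduced_state N D j (ket_bra v) $$ (s, t))"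
  using assms by (simp add: reduced_state_ket_bra_index mult.commute)

lemma local_observables_eq:
  "local_observables N D j = (\<lambda>X. tensor_at N D j X (1\<^sub>m (rest_dim N D j))) `
     {X \<in> traceless_hermitian (D j). mtrace (X * X) = 1}"
  by (auto simp: local_observables_def)

text \<open>The collapsed state is a product, so both expectation values are traces of
  \<open>X\<close> against matrices on party \<open>j\<close> alone. The deviation becomes the
  square of a linear functional of \<open>X\<close>, ready for Cauchy--Schwarz.\<close>

lemma deviation_local_observable:
  assumes v: "v \<in> carrier_vec (total_dim N D)"
    and \<chi>: "\<chi> \<in> carrier_vec (rest_dim N D j)" "\<chi> \<bullet>c \<chi> = 1"
    and X: "X \<in> carrier_mat (D j) (D j)"
  defines "P \<equiv> tensor_at N D j (1\<^sub>m (D j)) (ket_bra \<chi>)"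
  shows "deviation (ket_bra v) P (tensor_at N D j X (1\<^sub>m (rest_dim N D j))) =
    (Re (mtrace ((reduced_state N D j (ket_bra v) -
       of_real (1 / expect (ket_bra v) P) \<cdot>\<^sub>m ket_bra (conditional_vec v \<chi>)) * X)))\<^sup>2"
proof -
  let ?T = "tensor_at N D j X (1\<^sub>m (rest_dim N D j))"
  let ?c = "1 / expect (ket_bra v) P" and ?K = "ket_bra (conditional_vec v \<chi>)"
  define w where "w = vec (total_dim N D)
    (\<lambda>a. conditional_vec v \<chi> $ digit N D j a * \<chi> $ del_digit N D j a)"
  have wc: "w \<in> carrier_vec (total_dim N D)" by (simp add: w_def)
  have Kc: "?K \<in> carrier_mat (D j) (D j)" by (intro ket_bra_carrier) simp
  have "mtrace (ket_bra w * ?T) = mtrace (?K * X)"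
    unfolding mtrace_local_observable[OF wc X]
    by (simp add: w_def reduced_state_product[OF conditional_vec_carrier \<chi>])
  then have "mtrace (post_state (ket_bra v) P * ?T) = of_real ?c * mtrace (?K * X)"
    unfolding post_state_def P_def collapse_ket_bra[OF v \<chi>(1)] w_def[symmetric]
    by (subst mtrace_smult_mult[OF ket_bra_carrier[OF wc]]) simp_all
  then show ?thesis
    by (simp add: deviation_def expect_def mtrace_local_observable[OF v X]
        mtrace_minus_smult_mult[OF reduced_state_carrier Kc X] del: of_real_divide)
qed

text \<open>The factor \<open>p\<close> cancels the normalization of the post-measurement state, so that the right-hand
  side is affine in the projector onto the conditional state and can be summed over all outcomes;
  it is also valid for \<open>p = 0\<close>.\<close>

lemma outcome_disturbance:
  assumes v: "v \<in> carrier_vec (total_dim N D)" "v \<bullet>c v = 1"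
    and X0: "X0 \<in> traceless_hermitian (D j)" "mtrace (X0 * X0) = 1"
    and \<chi>: "\<chi> \<in> carrier_vec (rest_dim N D j)" "\<chi> \<bullet>c \<chi> = 1"
  defines "P \<equiv> tensor_at N D j (1\<^sub>m (D j)) (ket_bra \<chi>)"
    and "R \<equiv> reduced_state N D j (ket_bra v)"
    and "K \<equiv> ket_bra (conditional_vec v \<chi>)"
  defines "p \<equiv> expect (ket_bra v) P"
  shows "(if p = 0 then 0
      else p * (GREATEST x. x \<in> deviation (ket_bra v) P ` local_observables N D j)) =
    p * Re (mtrace (R * R)) - 2 * Re (mtrace (R * K)) + Re (mtrace K)"
proof -
  let ?\<phi> = "conditional_vec v \<chi>"
  have Kc: "K \<in> carrier_mat (D j) (D j)" unfolding K_def by (intro ket_bra_carrier) simp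
  have Rc: "R \<in> carrier_mat (D j) (D j)" by (simp add: R_def)
  \<comment> \<open>A squared norm is real, so the \<open>Re\<close> in \<open>expect\<close> loses
    nothing.\<close>
  have p: "of_real p = ?\<phi> \<bullet>c ?\<phi>"
    unfolding p_def expect_def P_def mtrace_rest_projection[OF v(1) \<chi>(1)]
    by (subst (1 2) cscalar_prod_self) simp
  have K1: "mtrace K = of_real p"
    by (simp add: K_def mtrace_ket_bra p)
  have K2: "mtrace (K * K) = of_real (p\<^sup>2)"
    by (simp add: K_def mtrace_ket_bra_square[OF conditional_vec_carrier] p)
  show ?thesis
  proof (cases "p = 0")
    case True
    \<comment> \<open>Probability zero means that the conditional vector vanishes; then
      \<open>K\<close> vanishes and both sides are 0.\<close>
    then have "(\<Sum>s<D j. (cmod (?\<phi> $ s))\<^sup>2) = 0"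
      using p unfolding cscalar_prod_self by (simp add: conditional_vec_def flip: of_real_power of_real_sum)
    then have "?\<phi> $ s = 0" if "s < D j" for s
      using that by (subst (asm) sum_nonneg_eq_0_iff) auto
    then have "K $$ (s, t) = 0" if "s < D j" "t < D j" for s t
      using that by (simp add: K_def ket_bra_index[OF conditional_vec_carrier])
    then have "mtrace (R * K) = 0"
      by (simp add: mtrace_mult[OF Rc Kc])
    then show ?thesis
      using True K1 by simp
  next
    case False
    \<comment> \<open>The difference of the reduced states before and after the outcome; both have
      trace 1, hence \<open>B\<close> is traceless.\<close>
    define B where "B = R - of_real (1 / p) \<cdot>\<^sub>m K"
    have B: "B \<in> traceless_hermitian (D j)"
    proof (rule traceless_hermitianI)
      show "B \<in> carrier_mat (D j) (D j)"
        unfolding B_def using Kc by (intro minus_carrier_mat smult_carrier_mat)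
      have "mtrace B = v \<bullet>c v - of_real (1 / p) * of_real p"
        unfolding B_def mtrace_minus_smult[OF Rc Kc] K1 by (simp add: R_def mtrace_reduced_state[OF v(1)])
      then show "mtrace B = 0"
        using False v(2) by simp
      fix s t assume st: "s < D j" "t < D j"
      have "K $$ (t, s) = cnj (K $$ (s, t))"
        using st by (simp add: K_def ket_bra_index[OF conditional_vec_carrier])
      moreover have "R $$ (t, s) = cnj (R $$ (s, t))"
        unfolding R_def by (rule reduced_state_hermitian[OF v(1) st])
      ultimately show "B $$ (t, s) = cnj (B $$ (s, t))"
        using st by (simp add: B_def carrier_matD[OF Kc] carrier_matD[OF Rc])
    qed
    have "deviation (ket_bra v) P ` local_observables N D j =
        (\<lambda>X. (Re (mtrace (B * X)))\<^sup>2) ` {X \<in> traceless_hermitian (D j). mtrace (X * X) = 1}"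
      unfolding local_observables_eq image_image
    proof (intro image_cong refl)
      fix X assume "X \<in> {X \<in> traceless_hermitian (D j). mtrace (X * X) = 1}"
      then have "X \<in> carrier_mat (D j) (D j)" by (auto intro: traceless_hermitianD(1))
      from deviation_local_observable[OF v(1) \<chi> this]
      show "deviation (ket_bra v) P (tensor_at N D j X (1\<^sub>m (rest_dim N D j))) =
          (Re (mtrace (B * X)))\<^sup>2"
        by (simp only: B_def R_def K_def p_def P_def)
    qed
    then have "(GREATEST x. x \<in> deviation (ket_bra v) P ` local_observables N D j) =
        Re (mtrace (B * B))"
      using Greatest_Re_mtrace_mult_square[OF B X0] by simp
    also have "mtrace (B * B) =
        mtrace (R * R) - of_real (2 / p) * mtrace (R * K) + of_real ((1 / p)\<^sup>2 * p\<^sup>2)"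
      unfolding B_def mtrace_square_minus_smult[OF Rc Kc] K2 by simp
    \<comment> \<open>The final 1 is the purity of the conditional state \<open>K / p\<close>;
      multiplied by \<open>p\<close> it becomes the trace of \<open>K\<close>.\<close>
    also have "Re \<dots> = Re (mtrace (R * R)) - 2 / p * Re (mtrace (R * K)) + 1"
      using False by (simp add: power_divide del: of_real_divide)
    finally show ?thesis
      using False K1 by (simp add: field_simps)
  qed
qed

text \<open>Allows the sum over the set of projections to be rewritten as a sum over basis vectors.
  The block with digit \<open>j\<close> equal to 0 on both sides is a copy of
  \<open>ket_bra \<chi>\<close>.\<close>

lemma inj_on_rest_projection:
  assumes S: "orthonormal_basis (rest_dim N D j) S"
  shows "inj_on (\<lambda>\<chi>. tensor_at N D j (1\<^sub>m (D j)) (ket_bra \<chi>)) S"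
proof (rule inj_onI)
  fix \<chi> \<chi>' assume *: "\<chi> \<in> S" "\<chi>' \<in> S"
    and eq: "tensor_at N D j (1\<^sub>m (D j)) (ket_bra \<chi>) = tensor_at N D j (1\<^sub>m (D j)) (ket_bra \<chi>')"
  have c: "\<chi> \<in> carrier_vec (rest_dim N D j)" "\<chi>' \<in> carrier_vec (rest_dim N D j)"
    using * orthonormal_basis_completeness(2)[OF S] by auto
  have "ket_bra \<chi> $$ (r, u) = ket_bra \<chi>' $$ (r, u)"
    if "r < rest_dim N D j" "u < rest_dim N D j" for r u
    using arg_cong[OF eq, of "\<lambda>A. A $$ (ins_digit N D j 0 r, ins_digit N D j 0 u)"]
      tensor_at_ins_digit[OF D_pos that(1) D_pos that(2)] D_pos by simp
  then have "ket_bra \<chi> = ket_bra \<chi>'"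
    using c by (intro eq_matI) (simp_all add: ket_bra_def)
  then show "\<chi> = \<chi>'"
    using inj_on_ket_bra_orthonormal[OF S] * by (simp add: inj_on_def)
qed

text \<open>The probabilities add up to 1 and the operators \<open>K \<chi>\<close> to
  \<open>R\<close>, so the three terms of \<open>outcome_disturbance\<close> sum to
  \<open>Tr (R R) - 2 Tr (R R) + 1\<close>. The witness \<open>X0\<close> ensures that a normalized
  observable exists.\<close>

lemma local_disturbance_eq_purity:
  assumes v: "v \<in> carrier_vec (total_dim N D)" "v \<bullet>c v = 1"
    and X0: "X0 \<in> traceless_hermitian (D j)" "mtrace (X0 * X0) = 1"
    and M: "M \<in> rest_measurements N D j"
  shows "local_disturbance N D j M (ket_bra v) =
    1 - Re (mtrace (reduced_state N D j (ket_bra v) * reduced_state N D j (ket_bra v)))"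
proof -
  define P where "P = (\<lambda>\<chi>. tensor_at N D j (1\<^sub>m (D j)) (ket_bra \<chi>))"
  define R where "R = reduced_state N D j (ket_bra v)"
  define K where "K \<chi> = ket_bra (conditional_vec v \<chi>)" for \<chi>
  have Rc: "R \<in> carrier_mat (D j) (D j)" by (simp add: R_def)
  have Kc: "K \<chi> \<in> carrier_mat (D j) (D j)" for \<chi>
    unfolding K_def by (intro ket_bra_carrier) simp
  obtain S where S: "orthonormal_basis (rest_dim N D j) S" and MS: "M = P ` S"
    using M by (auto simp: rest_measurements_def P_def)
  have \<chi>: "\<chi> \<in> carrier_vec (rest_dim N D j)" "\<chi> \<bullet>c \<chi> = 1" if "\<chi> \<in> S" for \<chi>
    using that S orthonormal_basis_completeness(2)[OF S] by (auto simp: orthonormal_basis_def)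
  have K_sum: "(\<Sum>\<chi>\<in>S. K \<chi> $$ (s, t)) = R $$ (s, t)" if "s < D j" "t < D j" for s t
    unfolding K_def R_def by (rule sum_conditional_ket_bra[OF v(1) S that])
  have "(\<Sum>\<chi>\<in>S. mtrace (K \<chi>)) = (\<Sum>s<D j. \<Sum>\<chi>\<in>S. K \<chi> $$ (s, s))"
    by (subst sum.swap) (simp add: mtrace_def carrier_matD[OF Kc])
  also have "\<dots> = mtrace R"
    by (simp add: K_sum mtrace_def carrier_matD[OF Rc])
  finally have K1: "(\<Sum>\<chi>\<in>S. mtrace (K \<chi>)) = 1"
    using v by (simp add: R_def mtrace_reduced_state)
  have "(\<Sum>\<chi>\<in>S. mtrace (R * K \<chi>)) = (\<Sum>s<D j. \<Sum>t<D j. \<Sum>\<chi>\<in>S. R $$ (s, t) * K \<chi> $$ (t, s))"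
    unfolding mtrace_mult[OF Rc Kc]
    by (subst sum.swap) (intro sum.cong refl sum.swap)
  also have "\<dots> = mtrace (R * R)"
    unfolding mtrace_mult[OF Rc Rc] by (intro sum.cong refl) (simp add: K_sum flip: sum_distrib_left)
  finally have RK: "(\<Sum>\<chi>\<in>S. mtrace (R * K \<chi>)) = mtrace (R * R)" .
  have p: "expect (ket_bra v) (P \<chi>) = Re (mtrace (K \<chi>))" if "\<chi> \<in> S" for \<chi>
    unfolding expect_def P_def mtrace_rest_projection[OF v(1) \<chi>(1)[OF that]] K_def mtrace_ket_bra ..
  have "local_disturbance N D j M (ket_bra v) =
      (\<Sum>\<chi>\<in>S. if expect (ket_bra v) (P \<chi>) = 0 then 0 else expect (ket_bra v) (P \<chi>) *
         (GREATEST x. x \<in> deviation (ket_bra v) (P \<chi>) ` local_observables N D j))"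
    unfolding local_disturbance_def MS
    using inj_on_rest_projection[OF S, folded P_def] by (simp add: sum.reindex)
  also have "\<dots> = (\<Sum>\<chi>\<in>S. Re (mtrace (K \<chi>)) * Re (mtrace (R * R))
      - 2 * Re (mtrace (R * K \<chi>)) + Re (mtrace (K \<chi>)))"
  proof (intro sum.cong refl)
    fix \<chi> assume "\<chi> \<in> S"
    from outcome_disturbance[OF v X0 \<chi>[OF this]] p[OF this]
    show "(if expect (ket_bra v) (P \<chi>) = 0 then 0 else expect (ket_bra v) (P \<chi>) *
         (GREATEST x. x \<in> deviation (ket_bra v) (P \<chi>) ` local_observables N D j)) =
       Re (mtrace (K \<chi>)) * Re (mtrace (R * R)) - 2 * Re (mtrace (R * K \<chi>)) + Re (mtrace (K \<chi>))"
      by (simp only: P_def R_def K_def)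
  qed
  also have "\<dots> = Re (\<Sum>\<chi>\<in>S. mtrace (K \<chi>)) * Re (mtrace (R * R))
      - 2 * Re (\<Sum>\<chi>\<in>S. mtrace (R * K \<chi>)) + Re (\<Sum>\<chi>\<in>S. mtrace (K \<chi>))"
    by (simp add: sum.distrib sum_subtractf sum_distrib_left sum_distrib_right)
  also have "\<dots> = 1 - Re (mtrace (R * R))"
    unfolding K1 RK by simp
  finally show ?thesis by (simp add: R_def)
qed

text \<open>Parseval applies to the traceless part \<open>B\<close> of the reduced state. The
  subtracted multiple of the identity does not change the expectation values, because each
  \<open>A k\<close> is traceless.\<close>

lemma sum_local_expect_square:
  assumes v: "v \<in> carrier_vec (total_dim N D)" "v \<bullet>c v = 1" and A: "traceless_onb (D j) A"
  shows "(\<Sum>k\<in>{1..(D j)\<^sup>2 - 1}. (local_expect N D j (ket_bra v) (A k))\<^sup>2) =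
    Re (mtrace (reduced_state N D j (ket_bra v) * reduced_state N D j (ket_bra v))) - 1 / real (D j)"
proof -
  let ?d = "D j"
  define R where "R = reduced_state N D j (ket_bra v)"
  define B where "B = R - of_real (1 / real ?d) \<cdot>\<^sub>m 1\<^sub>m ?d"
  have Rc: "R \<in> carrier_mat ?d ?d" by (simp add: R_def)
  have R1: "mtrace R = 1" using v by (simp add: R_def mtrace_reduced_state)
  have I1: "mtrace (1\<^sub>m ?d) = of_nat ?d" by (simp add: mtrace_def)
  have B: "B \<in> traceless_hermitian ?d"
  proof (rule traceless_hermitianI)
    show "B \<in> carrier_mat ?d ?d"
      unfolding B_def by (intro minus_carrier_mat smult_carrier_mat) simp
    show "mtrace B = 0"
      unfolding B_def mtrace_minus_smult[OF Rc one_carrier_mat] R1 I1 using D_pos by simp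
    fix s t assume st: "s < ?d" "t < ?d"
    have "R $$ (t, s) = cnj (R $$ (s, t))"
      unfolding R_def by (rule reduced_state_hermitian[OF v(1) st])
    then show "B $$ (t, s) = cnj (B $$ (s, t))"
      using st by (simp add: B_def)
  qed
  have Ak: "A k \<in> traceless_hermitian ?d" if "k \<in> {1..?d\<^sup>2 - 1}" for k
    using A that by (auto simp: traceless_onb_def)
  have "(\<Sum>k\<in>{1..?d\<^sup>2 - 1}. (local_expect N D j (ket_bra v) (A k))\<^sup>2) =
      (\<Sum>k\<in>{1..?d\<^sup>2 - 1}. (Re (mtrace (B * A k)))\<^sup>2)"
  proof (intro sum.cong refl)
    fix k assume "k \<in> {1..?d\<^sup>2 - 1}"
    note k = Ak[OF this]
    note Akc = traceless_hermitianD(1)[OF k]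
    have "mtrace (B * A k) = mtrace (R * A k)"
      unfolding B_def mtrace_minus_smult_mult[OF Rc one_carrier_mat Akc]
      using Akc traceless_hermitianD(3)[OF k] by simp
    then show "(local_expect N D j (ket_bra v) (A k))\<^sup>2 = (Re (mtrace (B * A k)))\<^sup>2"
      by (simp add: local_expect_def expect_def mtrace_local_observable[OF v(1) Akc] R_def)
  qed
  also have "\<dots> = Re (mtrace (B * B))"
    by (rule traceless_onb_Parseval[OF A B, symmetric])
  \<comment> \<open>The cross term gives \<open>- 2 / D j\<close> and the square of the subtracted
    part \<open>1 / D j\<close>, together \<open>- 1 / D j\<close>.\<close>
  also have "mtrace (B * B) =
      mtrace (R * R) - 2 * of_real (1 / real ?d) + (of_real (1 / real ?d))\<^sup>2 * of_real (real ?d)"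
    unfolding B_def mtrace_square_minus_smult[OF Rc one_carrier_mat]
    using Rc R1 I1 by simp
  also have "Re \<dots> = Re (mtrace (R * R)) - 1 / real ?d"
    unfolding of_real_power[symmetric] of_real_mult[symmetric] using D_pos
    by (simp add: power2_eq_square)
  finally show ?thesis by (simp add: R_def)
qed

lemma rest_measurements_nonempty: "rest_measurements N D j \<noteq> {}"
  using orthonormal_basis_unit_vecs by (auto simp: rest_measurements_def)

end

section \<open>Independence of the measurement and the average over all parties\<close>

theorem mainTheorem4:
  fixes N :: nat
    and D :: "nat \<Rightarrow> nat"
    and A :: "nat \<Rightarrow> nat \<Rightarrow> complex mat"
    and \<psi> :: "complex vec"
    and \<rho> :: "complex mat"
  assumes "N \<ge> 2"
    and "\<And>j. j \<in> {1..N} \<Longrightarrow> D j \<ge> 2"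
    and "\<And>j. j \<in> {1..N} \<Longrightarrow> traceless_onb (D j) (A j)"
    and "\<psi> \<in> carrier_vec (total_dim N D)"
    and "\<psi> \<bullet>c \<psi> = 1"
    and "\<rho> = ket_bra \<psi>"
  shows "(\<forall>j\<in>{1..N}. \<forall>M\<in>rest_measurements N D j.
            local_disturbance N D j M \<rho> =
              1 - 1 / real (D j) - (\<Sum>k\<in>{1..(D j)\<^sup>2 - 1}. (local_expect N D j \<rho> (A j k))\<^sup>2))
       \<and> (\<forall>j\<in>{1..N}. \<forall>M\<in>rest_measurements N D j. \<forall>M'\<in>rest_measurements N D j.
            local_disturbance N D j M \<rho> = local_disturbance N D j M' \<rho>)
       \<and> general_entanglement N D \<rho> =
            1 - (1 / real N) * (\<Sum>j\<in>{1..N}. real (D j) / (real (D j) - 1) *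
              (\<Sum>k\<in>{1..(D j)\<^sup>2 - 1}. (local_expect N D j \<rho> (A j k))\<^sup>2))
       \<and> general_entanglement N D \<rho> =
            1 + (1 / real N) * (\<Sum>j\<in>{1..N}. 1 / (real (D j) - 1))
              - (1 / real N) * (\<Sum>j\<in>{1..N}. real (D j) / (real (D j) - 1) *
                  Re (mtrace (reduced_state N D j \<rho> * reduced_state N D j \<rho>)))"
proof -
  define pur where
    "pur j = Re (mtrace (reduced_state N D j \<rho> * reduced_state N D j \<rho>))" for j
  define L where "L j = (\<Sum>k\<in>{1..(D j)\<^sup>2 - 1}. (local_expect N D j \<rho> (A j k))\<^sup>2)" for j
  have party: "party N D j" if "j \<in> {1..N}" for j
  proof
    show "D k > 0" if "k \<in> {1..N}" for k using assms(2)[OF that] by simp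
  qed (rule that)
  have dist: "local_disturbance N D j M \<rho> = 1 - pur j"
    if j: "j \<in> {1..N}" and M: "M \<in> rest_measurements N D j" for j M
  proof -
    \<comment> \<open>Dimension at least 2 makes the index range of the basis nonempty, so
      \<open>A j 1\<close> can serve as the normalized traceless observable.\<close>
    have "2\<^sup>2 \<le> (D j)\<^sup>2" using assms(2)[OF j] by (rule power_mono) simp
    then have "1 \<in> {1..(D j)\<^sup>2 - 1}" by simp
    then have "A j 1 \<in> traceless_hermitian (D j)" "mtrace (A j 1 * A j 1) = 1"
      using assms(3)[OF j] unfolding traceless_onb_def by auto
    from party.local_disturbance_eq_purity[OF party[OF j] assms(4,5) this M]
    show ?thesis by (simp add: pur_def assms(6))
  qed
  have L: "L j = pur j - 1 / real (D j)" if j: "j \<in> {1..N}" for j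
    using party.sum_local_expect_square[OF party[OF j] assms(4,5) assms(3)[OF j]]
    by (simp add: L_def pur_def assms(6))
  have "(GREATEST x. x \<in> (\<lambda>M. local_disturbance N D j M \<rho>) ` rest_measurements N D j) = 1 - pur j"
    if j: "j \<in> {1..N}" for j
  proof -
    \<comment> \<open>All measurements give the same value and at least one exists, so the maximum
      is taken over a singleton.\<close>
    have "(\<lambda>M. local_disturbance N D j M \<rho>) ` rest_measurements N D j = {1 - pur j}"
      using party.rest_measurements_nonempty[OF party[OF j]] dist[OF j] by auto
    then show ?thesis by (auto intro: Greatest_equality)
  qed
  then have ge: "general_entanglement N D \<rho> =
      (1 / real N) * (\<Sum>j\<in>{1..N}. inverse (1 - 1 / real (D j)) * (1 - pur j))"
    by (simp add: general_entanglement_def)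
  have weight: "inverse (1 - 1 / real (D j)) * (1 - pur j) =
      1 - real (D j) / (real (D j) - 1) * L j"
    "inverse (1 - 1 / real (D j)) * (1 - pur j) =
      1 + 1 / (real (D j) - 1) - real (D j) / (real (D j) - 1) * pur j"
    if j: "j \<in> {1..N}" for j
  proof -
    have "real (D j) \<ge> 2" using assms(2)[OF j] by simp
    \<comment> \<open>The weight exceeds 1 by \<open>1 / (D j - 1)\<close>, which is also the
      weighted value of the \<open>1 / D j\<close> contained in \<open>L j\<close>. The two cancel
      in the formula with expectation values; the excess survives in the formula with
      purities.\<close>
    then have "inverse (1 - 1 / real (D j)) = real (D j) / (real (D j) - 1)"
      and "real (D j) / (real (D j) - 1) = 1 + 1 / (real (D j) - 1)"
      and "real (D j) / (real (D j) - 1) * (1 / real (D j)) = 1 / (real (D j) - 1)"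
      by (simp_all add: field_simps)
    then show "inverse (1 - 1 / real (D j)) * (1 - pur j) =
        1 - real (D j) / (real (D j) - 1) * L j"
      and "inverse (1 - 1 / real (D j)) * (1 - pur j) =
        1 + 1 / (real (D j) - 1) - real (D j) / (real (D j) - 1) * pur j"
      unfolding L[OF j] right_diff_distrib by (simp_all only: mult_1_right)
  qed
  have N: "1 / real N * real N = 1" using assms(1) by simp
  have "general_entanglement N D \<rho> =
        (1 / real N) * (\<Sum>j\<in>{1..N}. 1 - real (D j) / (real (D j) - 1) * L j)"
    by (simp only: ge weight(1) cong: sum.cong)
  moreover have "general_entanglement N D \<rho> =
        (1 / real N) * (\<Sum>j\<in>{1..N}. 1 + 1 / (real (D j) - 1) - real (D j) / (real (D j) - 1) * pur j)"
    by (simp only: ge weight(2) cong: sum.cong)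
  ultimately have "general_entanglement N D \<rho> =
        1 - (1 / real N) * (\<Sum>j\<in>{1..N}. real (D j) / (real (D j) - 1) * L j)"
    and "general_entanglement N D \<rho> =
        1 + (1 / real N) * (\<Sum>j\<in>{1..N}. 1 / (real (D j) - 1))
          - (1 / real N) * (\<Sum>j\<in>{1..N}. real (D j) / (real (D j) - 1) * pur j)"
    by (simp_all add: N sum_subtractf sum.distrib right_diff_distrib distrib_left
        del: times_divide_eq_left times_divide_eq_right)
  moreover have "local_disturbance N D j M \<rho> = 1 - 1 / real (D j) - L j"
    if "j \<in> {1..N}" "M \<in> rest_measurements N D j" for j M
    using dist[OF that] L[OF that(1)] by simp
  ultimately show ?thesis
    unfolding L_def pur_def by simp
qed

end
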